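(* Let $m,d$ be positive integers. Let $(X,\mu)$ be a totally ordered sigma-finite measure space, and let $\{\phi_{k,r}\mid 1\le k\le2m,\ 1\le r\le d\}$ be a collection of real-valued functions on $X$. Suppose for each $k=1,\dots,2m$ that the kernel $K_k(t,r)=\phi_{k,r}(t)$, $(t,r)\in X\times\{1,\dots,d\}$, is TP$_d$. Define the multidimensional array $$A(r_1,\dots,r_{2m})=\int_X\prod_{k=1}^{2m}\phi_{k,r_k}(x)\,\mathrm{d}\mu(x),\qquad 1\le r_1,\dots,r_{2m}\le d,$$ where the integrals are assumed to converge absolutely. Then the array $(A(r_1,\dots,r_{2m}))_{1\le r_1,\dots,r_{2m}\le d}$ is hyperdeterminantal totally positive of order $d$ (HTP$_d$).
   Context: For totally ordered sets $S,T$, a kernel $K\colon S\times T\to\mathbb{R}$ is totally positive of order $d$ (TP$_d$) if for all $n=1,\dots,d$ and all $s_1>\cdots>s_n$ in $S$ and $t_1>\cdots>t_n$ in $T$, the $n\times n$ determinant $\det(K(s_i,t_j))_{1\le i,j\le n}$ is nonnegative. For an array $B=(B(r_1,\dots,r_{2m}))_{1\le r_1,\dots,r_{2m}\le n}$ of numbers, its (Cayley first) hyperdeterminant is $$\operatorname{Det}(B(r_1,\dots,r_{2m}))_{1\le r_1,\dots,r_{2m}\le n}=\frac{1}{n!}\sum_{\sigma_1\in\mathfrak{S}_n}\cdots\sum_{\sigma_{2m}\in\mathfrak{S}_n}\left(\prod_{k=1}^{2m}\operatorname{sgn}(\sigma_k)\right)\prod_{j=1}^nB(\sigma_1(j),\dots,\sigma_{2m}(j)),$$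 where $\mathfrak{S}_n$ is the symmetric group on $n$ symbols. The array $(A(r_1,\dots,r_{2m}))_{1\le r_1,\dots,r_{2m}\le d}$ is HTP$_d$ if all its hyperdeterminantal minors are nonnegative, i.e. for all $n=1,\dots,d$ and all index sequences $i_{k,1}>\cdots>i_{k,n}$ in $\{1,\dots,d\}$, $1\le k\le2m$, $$\operatorname{Det}(A(i_{1,r_1},i_{2,r_2},\dots,i_{2m,r_{2m}}))_{1\le r_1,\dots,r_{2m}\le n}\ge0.$$ *)

theory Defs
  imports
    "HOL-Analysis.Bochner_Integration"
    "HOL-Library.FuncSet"
    "HOL-Combinatorics.Permutations"
    "Jordan_Normal_Form.Determinant"
begin

definition totally_positive ::
  "nat \<Rightarrow> 's::linorder set \<Rightarrow> 't::linorder set \<Rightarrow> ('s \<Rightarrow> 't \<Rightarrow> real) \<Rightarrow> bool" where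
  "totally_positive d S T K \<longleftrightarrow>
     (\<forall>n\<in>{1..d}. \<forall>s t.
        s ` {..<n} \<subseteq> S \<and> strict_antimono_on {..<n} s \<and>
        t ` {..<n} \<subseteq> T \<and> strict_antimono_on {..<n} t \<longrightarrow>
        Determinant.det (mat n n (\<lambda>(i, j). K (s i) (t j))) \<ge> 0)"

text \<open>
  A \<open>2m\<close>-dimensional array is a function \<open>B\<close> on index tuples; the tuple
  \<open>(r\<^sub>1, \<dots>, r\<^sub>2\<^sub>m)\<close> is a function on \<open>{1..2*m}\<close>, and an array is only ever evaluated at
  tuples that are \<^const>\<open>undefined\<close> outside this set, so each tuple has a unique representative.
\<close>

definition hyperdet :: "nat \<Rightarrow> nat \<Rightarrow> ((nat \<Rightarrow> nat) \<Rightarrow> real) \<Rightarrow> real" where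
  "hyperdet m n B = 1 / fact n *
     (\<Sum>\<sigma> \<in> {1..2*m} \<rightarrow>\<^sub>E {p. p permutes {1..n}}.
        (\<Prod>k=1..2*m. real_of_int (sign (\<sigma> k))) *
        (\<Prod>j=1..n. B (\<lambda>k\<in>{1..2*m}. \<sigma> k j)))"

definition hyperdet_totally_positive :: "nat \<Rightarrow> nat \<Rightarrow> ((nat \<Rightarrow> nat) \<Rightarrow> real) \<Rightarrow> bool" where
  "hyperdet_totally_positive m d A \<longleftrightarrow>
     (\<forall>n\<in>{1..d}. \<forall>i :: nat \<Rightarrow> nat \<Rightarrow> nat.
        (\<forall>k\<in>{1..2*m}. i k ` {1..n} \<subseteq> {1..d} \<and> strict_antimono_on {1..n} (i k)) \<longrightarrow>
        hyperdet m n (\<lambda>r. A (\<lambda>k\<in>{1..2*m}. i k (r k))) \<ge> 0)"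

end

theory Submission
  imports Defs
begin

text \<open>
  Fix a hyperdeterminantal minor of order \<open>n\<close>. Each factor of a term of the hyperdeterminant is
  an integral over \<open>X\<close>, so by Fubini the product of the \<open>n\<close> factors is one integral over \<open>X\<^sup>n\<close>, with
  a separate variable \<open>x\<^sub>j\<close> for each \<open>j\<close>. Under this integral the sum over \<open>2m\<close>-tuples of
  permutations factors as a product of \<open>2m\<close> independent sums, and each of these is the Leibniz
  expansion of an ordinary determinant. Hence
  \[ \mathrm{Det} = \frac{1}{n!} \int_{X^n} \prod_{k=1}^{2m}
       \det\bigl(\phi_{k, i_{k,b}}(x_a)\bigr)_{1 \le a, b \le n} \, d\mu^n(x), \]
  a form of the Binet--Cauchy (Andreief) identity: lemma \<open>hyperdet_integral\<close>.

  The integrand is pointwise nonnegative: lemma \<open>prod_leibniz_nonneg\<close>. If two coordinates of \<open>x\<close>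
  agree, every determinant has two equal rows and vanishes. Otherwise a permutation \<open>q\<close> of the rows
  puts the coordinates in decreasing order, where total positivity makes all determinants
  nonnegative; the permutation costs a factor \<open>sign q\<close> in each determinant, and since the number of
  determinants is even these factors cancel.
\<close>

section \<open>Determinants over a finite index set\<close>

text \<open>
  The indices of a hyperdeterminant start at \<open>1\<close>, those of a matrix at \<open>0\<close>. Expanding the determinant
  over an arbitrary index set serves both conventions and confines the shift to one reindexing.
\<close>

definition leibniz :: "'i set \<Rightarrow> ('i \<Rightarrow> 'i \<Rightarrow> real) \<Rightarrow> real" where
  "leibniz S f = (\<Sum>p | p permutes S. real_of_int (sign p) * (\<Prod>j\<in>S. f j (p j)))"

lemma leibniz_reindex:
  assumes "finite A" "bij_betw h A B"
  shows "leibniz B f = leibniz A (\<lambda>a b. f (h a) (h b))"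
proof -
  have inj: "inj_on h A" and B: "B = h ` A"
    using assms(2) by (auto simp: bij_betw_def)
  have "bij_betw (map_permutation A h) {p. p permutes A} {p. p permutes B}"
  proof (rule iffD1[OF bij_betw_cong bij_betw_permutations[OF assms(2)]])
    fix p
    show "(\<lambda>x. if x \<in> B then h (p (inv_into A h x)) else x) = map_permutation A h p"
      by (auto simp: map_permutation_def restrict_id_def B)
  qed
  then have "leibniz B f = (\<Sum>p | p permutes A. real_of_int (sign (map_permutation A h p)) *
      (\<Prod>j\<in>B. f j (map_permutation A h p j)))"
    unfolding leibniz_def by (rule sum.reindex_bij_betw[symmetric])
  also have "\<dots> = leibniz A (\<lambda>a b. f (h a) (h b))"
    unfolding leibniz_def
  proof (rule sum.cong[OF refl])
    fix p assume "p \<in> {p. p permutes A}"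
    then show "real_of_int (sign (map_permutation A h p)) *
        (\<Prod>j\<in>B. f j (map_permutation A h p j)) =
        real_of_int (sign p) * (\<Prod>j\<in>A. f (h j) (h (p j)))"
      using assms inj by (simp add: sign_map_permutation B prod.reindex map_permutation_apply)
  qed
  finally show ?thesis .
qed

lemma det_eq_leibniz:
  "Determinant.det (mat n n (\<lambda>(a, b). f (Suc a) (Suc b))) = leibniz {1..n} f"
proof -
  have "bij_betw Suc {0..<n} {1..n}"
    by (auto simp: bij_betw_def image_Suc_atLeastLessThan)
  then have "leibniz {1..n} f = leibniz {0..<n} (\<lambda>a b. f (Suc a) (Suc b))"
    by (simp add: leibniz_reindex)
  also have "\<dots> = Determinant.det (mat n n (\<lambda>(a, b). f (Suc a) (Suc b)))"
    unfolding leibniz_def det_def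
    by (auto intro!: sum.cong prod.cong simp: permutes_nat_less)
  finally show ?thesis by simp
qed

lemma leibniz_permute_rows:
  assumes "finite S" "q permutes S"
  shows "leibniz S (\<lambda>j. f (q j)) = real_of_int (sign q) * leibniz S f"
proof -
  have "leibniz S (\<lambda>j. f (q j)) =
      (\<Sum>p | p permutes S. real_of_int (sign (p \<circ> q)) * (\<Prod>j\<in>S. f (q j) ((p \<circ> q) j)))"
    unfolding leibniz_def by (rule sum_permutations_compose_right[OF assms(2)])
  also have "\<dots> = (\<Sum>p | p permutes S.
      real_of_int (sign q) * (real_of_int (sign p) * (\<Prod>j\<in>S. f j (p j))))"
  proof (rule sum.cong[OF refl])
    fix p assume "p \<in> {p. p permutes S}"
    then have "sign (p \<circ> q) = sign p * sign q"
      using assms by (auto intro!: sign_compose permutation_permutes[THEN iffD2])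
    moreover have "(\<Prod>j\<in>S. f (q j) (p (q j))) = (\<Prod>j\<in>S. f j (p j))"
      by (rule prod.reindex_bij_betw[OF permutes_imp_bij[OF assms(2)], of "\<lambda>j. f j (p j)"])
    ultimately show "real_of_int (sign (p \<circ> q)) * (\<Prod>j\<in>S. f (q j) ((p \<circ> q) j)) =
        real_of_int (sign q) * (real_of_int (sign p) * (\<Prod>j\<in>S. f j (p j)))"
      by simp
  qed
  finally show ?thesis
    by (simp add: leibniz_def sum_distrib_left)
qed

text \<open>Exchanging the two equal rows changes the sign but not the matrix.\<close>

lemma leibniz_identical_rows:
  assumes "finite S" "a \<in> S" "b \<in> S" "a \<noteq> b" "f a = f b"
  shows "leibniz S f = 0"
proof -
  have "leibniz S f = leibniz S (\<lambda>j. f (Transposition.transpose a b j))"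
    using assms(5) by (intro arg_cong[of _ _ "leibniz S"]) (auto simp: Transposition.transpose_def)
  also have "\<dots> = - leibniz S f"
    using assms by (subst leibniz_permute_rows) (auto simp: permutes_swap_id sign_swap_id)
  finally show ?thesis by simp
qed

section \<open>Nonnegativity of the integrand\<close>

lemma ex_permutation_strict_antimono:
  fixes x :: "nat \<Rightarrow> 'a::linorder"
  assumes "inj_on x {1..n}"
  shows "\<exists>q. q permutes {1..n} \<and> strict_antimono_on {1..n} (x \<circ> q)"
proof -
  define xs where "xs = rev (sorted_list_of_set (x ` {1..n}))"
  have len: "length xs = n" and dist: "distinct xs" and set: "set xs = x ` {1..n}"
    using assms by (simp_all add: xs_def card_image)
  have sorted: "sorted_wrt (>) xs"
    by (simp add: xs_def sorted_wrt_rev)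
  define g where "g = (\<lambda>j. xs ! (j - 1))"
  define q where "q = (\<lambda>j. if j \<in> {1..n} then inv_into {1..n} x (g j) else j)"
  have "bij_betw (\<lambda>j. j - 1) {1..n} {..<n}"
    by (rule bij_betw_byWitness[where f' = Suc]) auto
  then have "bij_betw ((!) xs \<circ> (\<lambda>j. j - 1)) {1..n} (x ` {1..n})"
    using dist len set by (intro bij_betw_trans[OF _ bij_betw_nth]) auto
  then have g: "bij_betw g {1..n} (x ` {1..n})"
    by (simp add: g_def comp_def)
  then have "bij_betw (inv_into {1..n} x \<circ> g) {1..n} {1..n}"
    using assms by (intro bij_betw_trans[OF g] bij_betw_inv_into) (simp add: bij_betw_def)
  then have "bij_betw q {1..n} {1..n}"
    by (rule iffD1[OF bij_betw_cong, rotated]) (simp add: q_def)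
  then have "q permutes {1..n}"
    by (rule bij_imp_permutes) (auto simp: q_def)
  moreover have "strict_antimono_on {1..n} (x \<circ> q)"
  proof (rule monotone_onI)
    fix a b assume ab: "a \<in> {1..n}" "b \<in> {1..n}" "a < b"
    have "x (q j) = g j" if "j \<in> {1..n}" for j
      using that bij_betwE[OF g] by (simp add: q_def f_inv_into_f)
    moreover have "g a > g b"
      unfolding g_def using ab len by (intro sorted_wrt_nth_less[OF sorted]) auto
    ultimately show "(x \<circ> q) b < (x \<circ> q) a"
      using ab by simp
  qed
  ultimately show ?thesis by blast
qed

lemma totally_positive_leibniz_nonneg:
  assumes "totally_positive d S T K" "n \<in> {1..d}"
    and "s ` {1..n} \<subseteq> S" "strict_antimono_on {1..n} s"
    and "t ` {1..n} \<subseteq> T" "strict_antimono_on {1..n} t"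
  shows "leibniz {1..n} (\<lambda>a b. K (s a) (t b)) \<ge> 0"
proof -
  have "(s \<circ> Suc) ` {..<n} \<subseteq> S" "(t \<circ> Suc) ` {..<n} \<subseteq> T"
    using assms(3,5) by auto
  moreover have "strict_antimono_on {..<n} (s \<circ> Suc)" "strict_antimono_on {..<n} (t \<circ> Suc)"
    using assms(4,6) by (auto simp: monotone_on_def)
  ultimately have "Determinant.det (mat n n (\<lambda>(a, b). K ((s \<circ> Suc) a) ((t \<circ> Suc) b))) \<ge> 0"
    using assms(1,2) unfolding totally_positive_def by blast
  then show ?thesis
    using det_eq_leibniz[of n "\<lambda>a b. K (s a) (t b)"] by simp
qed

text \<open>
  The individual determinants change sign with the order of the coordinates of \<open>x\<close>, all of them in
  the same way; only the product of evenly many of them is nonnegative for every \<open>x\<close>.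
\<close>

lemma prod_leibniz_nonneg:
  fixes x :: "nat \<Rightarrow> 'a::linorder"
  assumes "finite I" "even (card I)" "n \<in> {1..d}"
    and "\<And>k. k \<in> I \<Longrightarrow> totally_positive d S T (K k)"
    and "\<And>k. k \<in> I \<Longrightarrow> t k ` {1..n} \<subseteq> T"
    and "\<And>k. k \<in> I \<Longrightarrow> strict_antimono_on {1..n} (t k)"
    and "x ` {1..n} \<subseteq> S"
  shows "(\<Prod>k\<in>I. leibniz {1..n} (\<lambda>a b. K k (x a) (t k b))) \<ge> 0"
proof (cases "inj_on x {1..n}")
  case True
  then obtain q where q: "q permutes {1..n}" and anti: "strict_antimono_on {1..n} (x \<circ> q)"
    using ex_permutation_strict_antimono by blast
  let ?D = "\<lambda>k x. leibniz {1..n} (\<lambda>a b. K k (x a) (t k b))"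
  have img: "(x \<circ> q) ` {1..n} \<subseteq> S"
    using assms(7) permutes_in_image[OF q] by (auto simp: image_subset_iff)
  have "0 \<le> (\<Prod>k\<in>I. ?D k (x \<circ> q))"
    using assms anti img by (intro prod_nonneg totally_positive_leibniz_nonneg[where s = "x \<circ> q"])
  also have "\<dots> = (\<Prod>k\<in>I. real_of_int (sign q) * ?D k x)"
    using leibniz_permute_rows[OF _ q, of "\<lambda>a b. K _ (x a) (t _ b)"] by simp
  also have "\<dots> = real_of_int (sign q) ^ card I * (\<Prod>k\<in>I. ?D k x)"
    by (simp add: prod.distrib)
  also have "real_of_int (sign q) ^ card I = 1"
    using assms(2) by (simp add: sign_def)
  finally show ?thesis by simp
next
  case False
  then obtain a b where ab: "a \<in> {1..n}" "b \<in> {1..n}" "a \<noteq> b" "x a = x b"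
    by (auto simp: inj_on_def)
  then have "leibniz {1..n} (\<lambda>a b. K k (x a) (t k b)) = 0" for k
    by (intro leibniz_identical_rows[of _ a b]) auto
  then show ?thesis by simp
qed

section \<open>The hyperdeterminant as an integral\<close>

text \<open>
  What is integrable here is the product over \<open>k\<close> at one point, not each \<open>f k r\<close> separately. The
  determinants are therefore multiplied out before integrating: the term of \<open>\<sigma>\<close> regroups as a
  product over \<open>j\<close> of functions \<open>\<Prod>k. f k (\<sigma> k j)\<close> of the single variable \<open>x j\<close>, and to such a
  product Fubini applies.
\<close>

lemma hyperdet_integral:
  fixes f :: "nat \<Rightarrow> nat \<Rightarrow> 'a \<Rightarrow> real"
  assumes "sigma_finite_measure M"
    and int: "\<And>r. r \<in> {1..2*m} \<rightarrow>\<^sub>E {1..n} \<Longrightarrow> integrable M (\<lambda>x. \<Prod>k=1..2*m. f k (r k) x)"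
  shows "hyperdet m n (\<lambda>r. \<integral>x. (\<Prod>k=1..2*m. f k (r k) x) \<partial>M) =
    1 / fact n * (\<integral>x. (\<Prod>k=1..2*m. leibniz {1..n} (\<lambda>a b. f k b (x a))) \<partial>Pi\<^sub>M {1..n} (\<lambda>_. M))"
proof -
  interpret product_sigma_finite "\<lambda>_::nat. M"
    using assms(1) by (simp add: product_sigma_finite_def)
  let ?P = "{1..2*m} \<rightarrow>\<^sub>E {p. p permutes {1..n}}"
  let ?s = "\<lambda>\<sigma>. \<Prod>k=1..2*m. real_of_int (sign (\<sigma> k))"
  have int': "integrable M (\<lambda>x. \<Prod>k=1..2*m. f k (\<sigma> k j) x)" if "\<sigma> \<in> ?P" "j \<in> {1..n}" for \<sigma> j
  proof -
    have "\<sigma> k j \<in> {1..n}" if "k \<in> {1..2*m}" for k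
      using \<open>\<sigma> \<in> ?P\<close> \<open>j \<in> {1..n}\<close> that permutes_in_image[of "\<sigma> k" "{1..n}" j] by (auto simp: PiE_iff)
    then have "integrable M (\<lambda>x. \<Prod>k=1..2*m. f k ((\<lambda>k\<in>{1..2*m}. \<sigma> k j) k) x)"
      by (intro int) auto
    then show ?thesis by simp
  qed
  have expand: "(\<Prod>k=1..2*m. leibniz {1..n} (\<lambda>a b. f k b (x a))) =
      (\<Sum>\<sigma>\<in>?P. ?s \<sigma> * (\<Prod>j=1..n. \<Prod>k=1..2*m. f k (\<sigma> k j) (x j)))" for x
    unfolding leibniz_def
    by (simp add: prod_sum_PiE finite_permutations prod.distrib prod.swap[of _ "{1..2*m}"]
        del: One_nat_def)
  have "(\<integral>x. (\<Prod>k=1..2*m. leibniz {1..n} (\<lambda>a b. f k b (x a))) \<partial>Pi\<^sub>M {1..n} (\<lambda>_. M)) =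
      (\<Sum>\<sigma>\<in>?P. ?s \<sigma> *
        (\<integral>x. (\<Prod>j=1..n. \<Prod>k=1..2*m. f k (\<sigma> k j) (x j)) \<partial>Pi\<^sub>M {1..n} (\<lambda>_. M)))"
    unfolding expand
    by (subst Bochner_Integration.integral_sum)
      (intro integrable_mult_right product_integrable_prod int' finite_atLeastAtMost
        | assumption | simp only: integral_mult_right_zero)+
  also have "\<dots> = (\<Sum>\<sigma>\<in>?P. ?s \<sigma> * (\<Prod>j=1..n. \<integral>x. (\<Prod>k=1..2*m. f k (\<sigma> k j) x) \<partial>M))"
    by (intro sum.cong refl arg_cong2[where f = "(*)"] product_integral_prod int') auto
  finally show ?thesis
    unfolding hyperdet_def by simp
qed

section \<open>Hyperdeterminantal total positivity\<close>

theorem proposition5p9: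
  fixes m d :: nat
    and M :: "'a::linorder measure"
    and \<phi> :: "nat \<Rightarrow> nat \<Rightarrow> 'a \<Rightarrow> real"
  assumes "m \<ge> 1" and "d \<ge> 1"
    and "sigma_finite_measure M"
    and "\<And>k. k \<in> {1..2*m} \<Longrightarrow> totally_positive d (space M) {1..d} (\<lambda>t r. \<phi> k r t)"
    and "\<And>r. r \<in> {1..2*m} \<rightarrow>\<^sub>E {1..d} \<Longrightarrow> integrable M (\<lambda>x. \<Prod>k=1..2*m. \<phi> k (r k) x)"
  shows "hyperdet_totally_positive m d (\<lambda>r. \<integral>x. (\<Prod>k=1..2*m. \<phi> k (r k) x) \<partial>M)"
  unfolding hyperdet_totally_positive_def
proof (intro ballI allI impI)
  fix n and i :: "nat \<Rightarrow> nat \<Rightarrow> nat"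
  assume n: "n \<in> {1..d}"
    and i: "\<forall>k\<in>{1..2*m}. i k ` {1..n} \<subseteq> {1..d} \<and> strict_antimono_on {1..n} (i k)"
  have "integrable M (\<lambda>x. \<Prod>k=1..2*m. \<phi> k (i k (r k)) x)" if "r \<in> {1..2*m} \<rightarrow>\<^sub>E {1..n}" for r
  proof -
    have "(\<lambda>k\<in>{1..2*m}. i k (r k)) \<in> {1..2*m} \<rightarrow>\<^sub>E {1..d}"
      using that i by (fastforce simp: PiE_iff)
    from assms(5)[OF this] show ?thesis by simp
  qed
  note eq = hyperdet_integral[where f = "\<lambda>k r. \<phi> k (i k r)", OF assms(3) this]
  have "0 \<le> (\<Prod>k=1..2*m. leibniz {1..n} (\<lambda>a b. \<phi> k (i k b) (x a)))"
    if "x \<in> space (Pi\<^sub>M {1..n} (\<lambda>_. M))" for x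
    using that assms(4) i n
    by (intro prod_leibniz_nonneg[where S = "space M" and T = "{1..d}" and d = d
          and K = "\<lambda>k t r. \<phi> k r t"]) (auto simp: space_PiM PiE_iff)
  then show "hyperdet m n (\<lambda>r. (\<lambda>r. \<integral>x. (\<Prod>k=1..2*m. \<phi> k (r k) x) \<partial>M)
      (\<lambda>k\<in>{1..2*m}. i k (r k))) \<ge> 0"
    using eq by (simp add: integral_nonneg del: One_nat_def)
qed

end
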